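(* Let $m=(m(p))_{p\ge 0}$ be a kernel moment sequence (as defined in the context), let $n\ge 1$ be an integer and let $A\in\mathbb{C}^{n\times n}$ be a diagonalizable matrix. Then the general solution of the linear system of moment differential equations $\partial_m y(z)=Ay(z)$ is given by $$y(z)=E(Az)v^c,$$ where $v^c$ is an $n$-dimensional constant column vector. That is, the set of solutions $y\in(\mathcal{O}(\mathbb{C}))^n$ of $\partial_m y=Ay$ is exactly $\{E(Az)v^c: v^c\in\mathbb{C}^n\}$.
   Context: Notation. $\mathcal{O}(U)$ is the set of holomorphic functions on $U$. $D(z_0,r)$ is the open disc of center $z_0$ and radius $r$. For $d\in\mathbb{R}$ and $\theta>0$, $S_d(\theta)$ is the sector of nonzero $z$ with $|\arg(z)-d|<\theta/2$ (regarded in the Riemann surface of the logarithm if $\theta>2\pi$). Strongly regular sequences. A sequence of positive reals $\mathbb{M}=(M_p)_{p\ge0}$ with $M_0=1$ is strongly regular if: (lc) $M_p^2\le M_{p-1}M_{p+1}$ for all $p\ge1$; (mg) there is $A>0$ with $M_{p+q}\le A^{p+q}M_pM_q$ for all $p,q\ge0$; (snq) there is $A>0$ with $\sum_{q\ge p}\frac{M_q}{(q+1)M_{q+1}}\le A\frac{M_p}{M_{p+1}}$ for all $p\ge0$. Put $M(0)=0$, $M(t)=\sup_{p\ge0}\log(t^p/M_p)$ for $t>0$, and $\rho(M)=\limsup_{r\to\infty}\frac{\log M(r)}{\log r}$. Proximate orders. A nonzero proximate order is a continuous, piecewise continuously differentiable function $\varrho:(c,\infty)\to[0,\infty)$, for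 some $c\ge0$, with $\lim_{t\to\infty}\varrho(t)\in(0,\infty)$ and $\lim_{t\to\infty}t\varrho'(t)\log t=0$. $\mathbb{M}$ admits a nonzero proximate order if there are a nonzero proximate order $\varrho$ and real constants $a,b$ with $a\le\log(t)\left(\varrho(t)-\frac{\log M(t)}{\log t}\right)\le b$ for all large $t$. Kernels. A pair of kernel functions for $\mathbb{M}$-summability is a pair $(e,E)$ such that: (1) $e\in\mathcal{O}(S_0(\pi/\rho(M)))$; there is $t_0>0$ such that for all $z_0\in S_0(\pi/\rho(M))$ there is $r_0>0$ with $D(z_0,r_0)\subseteq S_0(\pi/\rho(M))$ and $\int_0^{t_0}\sup_{z\in D(z_0,r_0)}|e(t/z)|\frac{dt}{t}<\infty$; and for every $\delta>0$ there are $K_1,K_2>0$ with $|e(z)|\le K_1\exp(-M(|z|/K_2))$ for $z\in S_0(\pi/\rho(M)-\delta)$; (2) $e(x)>0$ for all real $x>0$; (3) $E\in\mathcal{O}(\mathbb{C})$, $|E(z)|\le K_3\exp(M(|z|/K_4))$ for all $z\in\mathbb{C}$ and some $K_3,K_4>0$, and there is $\beta>0$ such that for all $0<\theta<2\pi-\pi/\rho(M)$ and $R>0$ there is $K_5>0$ with $|E(z)|\le K_5/|z|^\beta$ for $z\in S_\pi(\theta)\cap(\mathbb{C}\setminus D(0,R))$; (4) $E(z)=\sum_{p\ge0}\frac{z^p}{m(p)}$ for $z\in\mathbb{C}$, where $m(p)=\int_0^\infty t^{p-1}e(t)\,dt$ for $p\ge0$. Kernel moment sequence. $m=(m(p))_{p\ge0}$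 is called here a kernel moment sequence if it is the sequence of moments $m(p)=\int_0^\infty t^{p-1}e(t)\,dt$ of a pair of kernel functions $(e,E)$ for $\mathbb{M}$-summability, where $\mathbb{M}$ is a strongly regular sequence admitting a nonzero proximate order with $\lim_{p\to\infty}M_p^{1/p}=+\infty$, and moreover $m(0)=1$ and $\liminf_{p\to\infty}m(p)^{1/p}=+\infty$. Moment derivative. $\partial_m\left(\sum_{p\ge0}\frac{a_p}{m(p)}z^p\right)=\sum_{p\ge0}\frac{a_{p+1}}{m(p)}z^p$; it acts on functions holomorphic near $0$ through their Taylor expansion at $0$, and componentwise on vectors of functions. Generalized matrix exponential. $E(Az)=\sum_{p\ge0}\frac{A^p}{m(p)}z^p$ for $A\in\mathbb{C}^{n\times n}$, which converges for all $z\in\mathbb{C}$. *)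

theory Defs
  imports "HOL-Complex_Analysis.Complex_Analysis"
begin

definition strongly_regular :: "(nat \<Rightarrow> real) \<Rightarrow> bool" where
  "strongly_regular M \<longleftrightarrow>
     (\<forall>p. M p > 0) \<and> M 0 = 1 \<and>
     (\<forall>p\<ge>1. (M p)\<^sup>2 \<le> M (p - 1) * M (p + 1)) \<and>
     (\<exists>A>0. \<forall>p q. M (p + q) \<le> A ^ (p + q) * M p * M q) \<and>
     (\<exists>A>0. \<forall>p.
        summable (\<lambda>k. M (p + k) / (real (p + k + 1) * M (p + k + 1))) \<and>
        (\<Sum>k. M (p + k) / (real (p + k + 1) * M (p + k + 1))) \<le> A * (M p / M (p + 1)))"

text \<open>The function \<open>M(t)\<close>. For strongly regular \<open>M\<close> the quotients \<open>M (p + 1) / M p\<close> tend to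
  infinity, so the supremum is finite.\<close>

definition assoc_fun :: "(nat \<Rightarrow> real) \<Rightarrow> real \<Rightarrow> real" where
  "assoc_fun M t = (if t > 0 then (SUP p. ln (t ^ p / M p)) else 0)"

definition growth_order :: "(nat \<Rightarrow> real) \<Rightarrow> ereal" where
  "growth_order M = Limsup at_top (\<lambda>r. ereal (ln (assoc_fun M r) / ln r))"

text \<open>The opening \<open>\<pi> / \<rho>(M)\<close> of the sectors below. If \<open>M\<close> admits a nonzero proximate order
  then \<open>\<rho>(M)\<close> is the limit of that order, hence lies in \<open>(0, \<infinity>)\<close>, and the conversion to
  \<^typ>\<open>real\<close> is harmless.\<close>

definition kernel_opening :: "(nat \<Rightarrow> real) \<Rightarrow> real" where
  "kernel_opening M = pi / real_of_ereal (growth_order M)"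

text \<open>Piecewise continuous differentiability on the open half-line is required on every compact
  subinterval, so the breakpoints form a locally finite set. The limit of \<open>t \<rho>'(t) log t\<close> is taken
  along the points where the derivative exists.\<close>

definition nonzero_proximate_order :: "real \<Rightarrow> (real \<Rightarrow> real) \<Rightarrow> bool" where
  "nonzero_proximate_order c \<rho> \<longleftrightarrow>
     c \<ge> 0 \<and> (\<forall>t>c. \<rho> t \<ge> 0) \<and>
     continuous_on {c<..} \<rho> \<and>
     (\<forall>a b. c < a \<and> a < b \<longrightarrow> \<rho> piecewise_C1_differentiable_on {a..b}) \<and>
     (\<exists>l>0. (\<rho> \<longlongrightarrow> l) at_top) \<and>
     ((\<lambda>t. t * deriv \<rho> t * ln t) \<longlongrightarrow> 0)
        (inf at_top (principal {t. \<rho> differentiable (at t)}))"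

definition admits_nonzero_proximate_order :: "(nat \<Rightarrow> real) \<Rightarrow> bool" where
  "admits_nonzero_proximate_order M \<longleftrightarrow>
     (\<exists>c \<rho> a b. nonzero_proximate_order c \<rho> \<and>
        (\<forall>\<^sub>F t in at_top.
           a \<le> ln t * (\<rho> t - ln (assoc_fun M t) / ln t) \<and>
           ln t * (\<rho> t - ln (assoc_fun M t) / ln t) \<le> b))"

text \<open>A point \<open>z\<close> of the Riemann surface of the logarithm is represented by \<open>w = log z\<close>, so that
  \<open>|z| = exp (Re w)\<close>, \<open>arg z = Im w\<close>, division is subtraction, and the projection to the punctured
  plane is \<^term>\<open>exp :: complex \<Rightarrow> complex\<close>. A sector becomes a strip, and a function \<open>e\<close> on the
  sector becomes the function \<open>w \<mapsto> e (exp w)\<close> on the strip; holomorphy is preserved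
  in both directions. For openings at most \<open>2 \<pi>\<close> the projection is injective on the strip,
  and this is the usual notion on a plane sector.\<close>

definition log_sector :: "real \<Rightarrow> real \<Rightarrow> complex set" where
  "log_sector d \<theta> = {w. \<bar>Im w - d\<bar> < \<theta> / 2}"

definition plane_sector :: "real \<Rightarrow> real \<Rightarrow> complex set" where
  "plane_sector d \<theta> = exp ` log_sector d \<theta>"

text \<open>The disc of radius \<open>r\<close> around the point represented by \<open>w0\<close>. It is only used for \<open>r\<close> at most
  the modulus of the centre, when it lies in a half-plane around the centre; the first condition
  selects the sheet.\<close>

definition log_disc :: "complex \<Rightarrow> real \<Rightarrow> complex set" where
  "log_disc w0 r = {w. \<bar>Im w - Im w0\<bar> < pi / 2 \<and> exp w \<in> ball (exp w0) r}"

text \<open>The moments \<open>m(p)\<close>; the value of the kernel at a point \<open>t > 0\<close> is \<open>e (ln t)\<close>.\<close>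

definition moment :: "(complex \<Rightarrow> complex) \<Rightarrow> nat \<Rightarrow> complex" where
  "moment e p = (LINT t:{0<..}|lborel.
      complex_of_real (t powi (int p - 1)) * e (complex_of_real (ln t)))"

definition kernel_pair ::
    "(nat \<Rightarrow> real) \<Rightarrow> (complex \<Rightarrow> complex) \<Rightarrow> (complex \<Rightarrow> complex) \<Rightarrow> bool" where
  "kernel_pair M e E \<longleftrightarrow>
     e holomorphic_on log_sector 0 (kernel_opening M) \<and>
     (\<exists>t0>0. \<forall>w0 \<in> log_sector 0 (kernel_opening M). \<exists>r0>0.
        r0 \<le> norm (exp w0) \<and>
        log_disc w0 r0 \<subseteq> log_sector 0 (kernel_opening M) \<and>
        (\<integral>\<^sup>+ t\<in>{0<..<t0}.
           (SUP w\<in>log_disc w0 r0. ennreal (norm (e (complex_of_real (ln t) - w)))) *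
           ennreal (1 / t) \<partial>lborel) < \<infinity>) \<and>
     (\<forall>\<delta>>0. \<exists>K1>0. \<exists>K2>0. \<forall>w \<in> log_sector 0 (kernel_opening M - \<delta>).
        norm (e w) \<le> K1 * exp (- assoc_fun M (norm (exp w) / K2))) \<and>
     (\<forall>x>0. e (complex_of_real (ln x)) \<in> \<real> \<and> Re (e (complex_of_real (ln x))) > 0) \<and>
     E holomorphic_on UNIV \<and>
     (\<exists>K3>0. \<exists>K4>0. \<forall>z. norm (E z) \<le> K3 * exp (assoc_fun M (norm z / K4))) \<and>
     (\<exists>\<beta>>0. \<forall>\<theta> R. 0 < \<theta> \<and> \<theta> < 2 * pi - kernel_opening M \<and> R > 0 \<longrightarrow>
        (\<exists>K5>0. \<forall>z \<in> plane_sector pi \<theta> \<inter> (UNIV - ball 0 R).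
           norm (E z) \<le> K5 / norm z powr \<beta>)) \<and>
     (\<forall>z. (\<lambda>p. z ^ p / moment e p) sums E z)"

definition kernel_moment_sequence :: "(nat \<Rightarrow> real) \<Rightarrow> bool" where
  "kernel_moment_sequence m \<longleftrightarrow>
     (\<exists>M e E. strongly_regular M \<and> admits_nonzero_proximate_order M \<and>
        filterlim (\<lambda>p. root p (M p)) at_top sequentially \<and>
        kernel_pair M e E \<and> (\<forall>p. complex_of_real (m p) = moment e p)) \<and>
     m 0 = 1 \<and>
     liminf (\<lambda>p. ereal (root p (m p))) = \<infinity>"

text \<open>If \<open>f_p\<close> are the Taylor coefficients of \<open>f\<close> at \<open>0\<close>, then \<open>a_p = m(p) f_p\<close>, so the
  coefficients \<open>a_(p+1) / m(p)\<close> of the moment derivative are as follows.\<close>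

definition moment_deriv :: "(nat \<Rightarrow> real) \<Rightarrow> (complex \<Rightarrow> complex) \<Rightarrow> complex \<Rightarrow> complex" where
  "moment_deriv m f = eval_fps (Abs_fps (\<lambda>p.
      complex_of_real (m (p + 1)) * fps_nth (fps_expansion f 0) (p + 1) / complex_of_real (m p)))"

definition moment_deriv_vec ::
    "(nat \<Rightarrow> real) \<Rightarrow> (complex \<Rightarrow> complex ^ 'n) \<Rightarrow> complex \<Rightarrow> complex ^ 'n" where
  "moment_deriv_vec m y z = (\<chi> i. moment_deriv m (\<lambda>x. y x $ i) z)"

definition diagonalizable :: "complex ^ 'n ^ 'n \<Rightarrow> bool" where
  "diagonalizable A \<longleftrightarrow>
     (\<exists>P D :: complex ^ 'n ^ 'n. invertible P \<and> (\<forall>i j. i \<noteq> j \<longrightarrow> D $ i $ j = 0) \<and>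
        A = P ** D ** matrix_inv P)"

text \<open>The library's \<open>^\<close> on \<^typ>\<open>complex ^ 'n ^ 'n\<close> is the componentwise power,
  hence a separate notion.\<close>

primrec matrix_power :: "complex ^ 'n ^ 'n \<Rightarrow> nat \<Rightarrow> complex ^ 'n ^ 'n" where
  "matrix_power A 0 = mat 1"
| "matrix_power A (Suc p) = A ** matrix_power A p"

text \<open>The matrix \<open>E(A z)\<close>, with the series taken entrywise. It depends on \<open>E\<close> only through its
  Taylor coefficients \<open>1 / m(p)\<close>.\<close>

definition gen_matrix_exp ::
    "(nat \<Rightarrow> real) \<Rightarrow> complex ^ 'n ^ 'n \<Rightarrow> complex \<Rightarrow> complex ^ 'n ^ 'n" where
  "gen_matrix_exp m A z =
     (\<chi> i j. \<Sum>p. matrix_power A p $ i $ j / complex_of_real (m p) * z ^ p)"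

end

theory Submission
  imports Defs "HOL-Probability.Sinc_Integral"
begin

text \<open>Comparing coefficients in \<open>\<partial>\<^sub>m y = A y\<close> gives \<open>m(p+1) y\<^sub>p\<^sub>+\<^sub>1 / m(p) = A y\<^sub>p\<close> for the vectors
  \<open>y\<^sub>p\<close> of Taylor coefficients, hence \<open>y\<^sub>p = A\<^sup>p y\<^sub>0 / m(p)\<close>, which is the expansion of
  \<open>E(A z) y\<^sub>0\<close>; conversely these coefficients satisfy the recursion. So the solution with initial
  value \<open>y\<^sub>0\<close> exists and is unique, provided that three analytic facts hold: no \<open>m(p)\<close> vanishes,
  \<open>\<Sum> z\<^sup>p / m(p)\<close> converges everywhere, and \<open>m(p+1) / m(p)\<close> grows at most geometrically. The last
  one ensures that the moment derivative of an entire function has an everywhere convergent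
  Taylor series, so that an equation between values becomes one between coefficients: the moment
  derivative is the sum of a series, whose values would carry no information where the series
  diverges.

  The three facts are proved in \<open>kernel_moment_growth\<close>, where the geometric bound is the main
  point. It comes from comparing \<open>m\<close> with \<open>M\<close>. The decay \<open>exp (- M(|z| / K\<^sub>2))\<close> of the kernel
  bounds \<open>m(p+1)\<close> from above by a geometric factor times \<open>M\<^sub>p + M\<^sub>p\<^sub>+\<^sub>2\<close>, and moderate growth of
  \<open>M\<close> absorbs the shift (\<open>moment_Suc_estimate\<close>). In the other direction \<open>1 / m(p)\<close> is a Taylor
  coefficient of \<open>E\<close>, which grows at most like \<open>exp (M(|z| / K\<^sub>4))\<close>; the Cauchy inequality on the
  circle where \<open>t\<^sup>p / M\<^sub>p\<close> is the maximal term bounds \<open>m(p)\<close> from below by a geometric factor times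
  \<open>M\<^sub>p\<close> (\<open>entire_coeff_bound\<close>). Dividing the two bounds gives the claim.\<close>

section \<open>The function associated with a sequence\<close>

text \<open>The supremum defining the associated function ranges over reals, so it bounds its terms only once
  it is known to be finite; the divergence of \<open>M\<^sub>p\<^sup>1\<^sup>/\<^sup>p\<close> makes all but finitely many terms nonpositive.\<close>

lemma le_exp_assoc_fun:
  assumes M: "\<And>p. M p > 0" and root: "filterlim (\<lambda>p. root p (M p)) at_top sequentially" and t: "t > 0"
  shows "t ^ p / M p \<le> exp (assoc_fun M t)"
proof -
  have "\<forall>\<^sub>F q in sequentially. t \<le> root q (M q)"
    using root by (simp add: filterlim_at_top)
  hence "\<forall>\<^sub>F q in sequentially. ln (t ^ q / M q) \<le> 0"
    using eventually_gt_at_top[of 0]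
  proof eventually_elim
    case (elim q)
    have "t ^ q \<le> root q (M q) ^ q"
      using elim t by (intro power_mono) auto
    also have "\<dots> = M q"
      using elim M[of q] by (simp add: real_root_pow_pos)
    finally show ?case using M[of q] t by simp
  qed
  then obtain N where N: "\<And>q. q \<ge> N \<Longrightarrow> ln (t ^ q / M q) \<le> 0"
    by (auto simp: eventually_sequentially)
  have "bdd_above (range (\<lambda>q. ln (t ^ q / M q)))"
  proof (rule bdd_above_mono)
    show "bdd_above ((\<lambda>q. ln (t ^ q / M q)) ` {..<N} \<union> {..0})"
      by (simp add: bdd_above_finite)
    show "range (\<lambda>q. ln (t ^ q / M q)) \<subseteq> (\<lambda>q. ln (t ^ q / M q)) ` {..<N} \<union> {..0}"
      using N by (force simp: not_less[symmetric])
  qed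
  hence "ln (t ^ p / M p) \<le> assoc_fun M t"
    using t by (auto simp: assoc_fun_def intro: cSUP_upper)
  thus ?thesis
    using t M[of p] by (metis divide_pos_pos exp_le_cancel_iff exp_ln zero_less_power)
qed

lemma exp_assoc_fun_le:
  assumes M: "\<And>p. M p > 0" and t: "t > 0" and le: "\<And>q. t ^ q / M q \<le> c"
  shows "exp (assoc_fun M t) \<le> c"
proof -
  have c: "c > 0" using le[of 0] M[of 0] by (smt (verit) divide_pos_pos power_0)
  have "assoc_fun M t \<le> ln c"
    using t M c le by (auto simp: assoc_fun_def intro!: cSUP_least ln_mono)
  thus ?thesis using c by (metis exp_le_cancel_iff exp_ln)
qed

text \<open>Consecutive terms of \<open>t\<^sup>q / M\<^sub>q\<close> have ratio \<open>t / s\<^sub>q\<close> with \<open>s\<^sub>q = M\<^sub>q\<^sub>+\<^sub>1 / M\<^sub>q\<close>, and log-convexity says that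
  \<open>s\<close> is increasing. For \<open>t = s\<^sub>p\<close> the terms therefore increase up to \<open>p\<close> and decrease afterwards.
  This identifies the radius at which the associated function is attained at a prescribed index.\<close>

lemma log_convex_term_max:
  fixes M :: "nat \<Rightarrow> real" and p q :: nat
  assumes M: "\<And>p. M p > 0" and lc: "\<And>p. p \<ge> 1 \<Longrightarrow> (M p)\<^sup>2 \<le> M (p - 1) * M (p + 1)"
  defines "t \<equiv> M (p + 1) / M p"
  shows "t ^ q / M q \<le> t ^ p / M p"
proof -
  define s where "s q = M (Suc q) / M q" for q
  have sp: "s q > 0" for q using M by (simp add: s_def)
  have "mono s"
  proof (rule incseq_SucI)
    fix q show "s q \<le> s (Suc q)"
      using lc[of "Suc q"] M[of q] M[of "Suc q"]
      by (simp add: s_def field_simps power2_eq_square)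
  qed
  note mono = monoD[OF this]
  have t: "t = s p" by (simp add: t_def s_def)
  have tp: "t > 0" using sp t by simp
  define a where "a q = t ^ q / M q" for q
  have ap: "a q > 0" for q using tp M by (simp add: a_def)
  have step: "a (Suc q) = a q * (t / s q)" for q
    using M[of q] M[of "Suc q"] by (simp add: a_def s_def field_simps)
  have up: "a q \<le> a p" if "q \<le> p"
    using that
  proof (induction rule: inc_induct)
    case (step n)
    have "1 \<le> t / s n" using mono[of n p] step sp[of n] t by simp
    hence "a n * 1 \<le> a n * (t / s n)" using ap[of n] by (intro mult_left_mono) auto
    with \<open>a (Suc n) = a n * (t / s n)\<close>[symmetric] step.IH show ?case by simp
  qed simp
  have down: "a q \<le> a p" if "p \<le> q"
    using that
  proof (induction rule: dec_induct)
    case (step n)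
    have "t / s n \<le> 1" using mono[of p n] step sp[of n] t by simp
    hence "a n * (t / s n) \<le> a n * 1" using ap[of n] by (intro mult_left_mono) auto
    with \<open>a (Suc n) = a n * (t / s n)\<close> step.IH show ?case by simp
  qed simp
  from up down have "a q \<le> a p" by linarith
  thus ?thesis by (simp add: a_def)
qed

text \<open>The sector on which the kernel lives contains the positive axis only if its opening is positive.
  The two-sided bound forces \<open>ln M(t) / ln t\<close> to have the same positive finite limit as the
  proximate order, and this limit is the growth order.\<close>

lemma kernel_opening_pos:
  assumes "admits_nonzero_proximate_order M"
  shows "kernel_opening M > 0"
proof -
  obtain c \<rho> a b where \<rho>: "nonzero_proximate_order c \<rho>" and
    ev: "\<forall>\<^sub>F t in at_top. a \<le> ln t * (\<rho> t - ln (assoc_fun M t) / ln t) \<and>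
           ln t * (\<rho> t - ln (assoc_fun M t) / ln t) \<le> b"
    using assms by (auto simp: admits_nonzero_proximate_order_def)
  obtain l where l: "l > 0" "(\<rho> \<longlongrightarrow> l) at_top"
    using \<rho> by (auto simp: nonzero_proximate_order_def)
  define h where "h t = \<rho> t - ln (assoc_fun M t) / ln t" for t
  have lim0: "((\<lambda>t. K / ln t) \<longlongrightarrow> 0) at_top" for K :: real
    by (intro tendsto_divide_0[OF tendsto_const] filterlim_at_top_imp_at_infinity ln_at_top)
  have "(h \<longlongrightarrow> 0) at_top"
  proof (rule tendsto_sandwich[OF _ _ lim0[of a] lim0[of b]])
    show "\<forall>\<^sub>F t in at_top. a / ln t \<le> h t"
      using ev eventually_gt_at_top[of 1]
      by eventually_elim (simp add: h_def[symmetric] field_simps)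
    show "\<forall>\<^sub>F t in at_top. h t \<le> b / ln t"
      using ev eventually_gt_at_top[of 1]
      by eventually_elim (simp add: h_def[symmetric] field_simps)
  qed
  from tendsto_diff[OF l(2) this] have "((\<lambda>t. ln (assoc_fun M t) / ln t) \<longlongrightarrow> l) at_top"
    by (simp add: h_def)
  hence "growth_order M = ereal l"
    unfolding growth_order_def by (intro lim_imp_Limsup) auto
  thus ?thesis using l by (simp add: kernel_opening_def)
qed

section \<open>The moments of a kernel\<close>

text \<open>The integrand is dominated by a multiple of \<open>1 / (1 + t\<^sup>2)\<close>: multiplying it by \<open>1 + t\<^sup>2\<close> produces the
  powers \<open>t\<^sup>k\<close> and \<open>t\<^sup>k\<^sup>+\<^sup>2\<close>, and each of them times \<open>exp (- M(t / K\<^sub>2))\<close> is bounded by the definition of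
  the associated function. One majorant thus handles both ends of the half-line.\<close>

lemma moment_Suc_estimate:
  fixes e :: "complex \<Rightarrow> complex" and k :: nat
  assumes M: "\<And>p. M p > 0" and root: "filterlim (\<lambda>p. root p (M p)) at_top sequentially"
    and cont: "continuous_on {0<..} (\<lambda>t. e (complex_of_real (ln t)))"
    and K: "K1 > 0" "K2 > 0"
    and bound: "\<And>t. t > 0 \<Longrightarrow> norm (e (complex_of_real (ln t))) \<le> K1 * exp (- assoc_fun M (t / K2))"
  defines "J \<equiv> (LINT t:{0<..}|lborel. inverse (1 + t\<^sup>2))"
  shows "set_integrable lborel {0<..}
           (\<lambda>t. complex_of_real (t ^ k) * e (complex_of_real (ln t)))" (is "set_integrable _ _ ?g")
    and "norm (moment e (Suc k)) \<le> K1 * (K2 ^ k * M k + K2 ^ (k + 2) * M (k + 2)) * J"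
proof -
  define B where "B = K1 * (K2 ^ k * M k + K2 ^ (k + 2) * M (k + 2))"
  have pw: "t ^ q * exp (- assoc_fun M (t / K2)) \<le> K2 ^ q * M q" if "t > 0" for t q
  proof -
    have "(t / K2) ^ q / M q \<le> exp (assoc_fun M (t / K2))"
      using that K by (intro le_exp_assoc_fun M root) auto
    thus ?thesis using K M[of q] by (simp add: exp_minus field_simps power_divide)
  qed
  have le: "norm (?g t) \<le> B * inverse (1 + t\<^sup>2)" if t: "t > 0" for t
  proof -
    let ?X = "exp (- assoc_fun M (t / K2))"
    have "norm (?g t) * (1 + t\<^sup>2) = norm (e (complex_of_real (ln t))) * (t ^ k * (1 + t\<^sup>2))"
      using t by (simp add: norm_mult norm_power)
    also have "\<dots> \<le> (K1 * ?X) * (t ^ k * (1 + t\<^sup>2))"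
      using t by (intro mult_right_mono bound) auto
    also have "\<dots> = K1 * (t ^ k * ?X + t ^ (k + 2) * ?X)"
      by (simp add: power_add algebra_simps power2_eq_square)
    also have "\<dots> \<le> B"
      unfolding B_def using K t by (intro mult_left_mono add_mono pw) auto
    finally show ?thesis by (simp add: divide_inverse[symmetric] pos_le_divide_eq add_pos_nonneg)
  qed
  have int1: "set_integrable lborel {0<..} (\<lambda>t::real. inverse (1 + t\<^sup>2))"
    using integrable_inverse_1_plus_square by (rule set_integrable_subset) auto
  have int2: "set_integrable lborel {0<..} (\<lambda>t::real. B * inverse (1 + t\<^sup>2))"
    using int1 by (rule set_integrable_mult_right)
  show int: "set_integrable lborel {0<..} ?g"
    unfolding set_integrable_def
  proof (rule Bochner_Integration.integrable_bound[OF int2[unfolded set_integrable_def]])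
    show "(\<lambda>t. indicat_real {0<..} t *\<^sub>R ?g t) \<in> borel_measurable lborel"
    proof -
      have "continuous_on {0<..} ?g" by (intro continuous_intros cont)
      thus ?thesis by (simp only: measurable_lborel2 borel_measurable_continuous_on_indicator
            borel_open open_greaterThan)
    qed
    show "AE t in lborel. norm (indicat_real {0<..} t *\<^sub>R ?g t)
            \<le> norm (indicat_real {0<..} t *\<^sub>R (B * inverse (1 + t\<^sup>2)))"
      using le by (intro AE_I2) (auto simp: indicator_def intro: order_trans[OF _ abs_ge_self])
  qed
  have "moment e (Suc k) = (LINT t:{0<..}|lborel. ?g t)"
    by (simp add: moment_def)
  also have "norm \<dots> \<le> (LINT t:{0<..}|lborel. norm (?g t))"
    using int by (rule set_integral_norm_bound)
  also have "\<dots> \<le> (LINT t:{0<..}|lborel. B * inverse (1 + t\<^sup>2))"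
    using int le by (intro set_integral_mono int2 set_integrable_norm) auto
  also have "\<dots> = B * J" by (simp add: J_def)
  finally show "norm (moment e (Suc k)) \<le> K1 * (K2 ^ k * M k + K2 ^ (k + 2) * M (k + 2)) * J"
    by (simp add: B_def)
qed

text \<open>The moment integrates a strictly positive function. Integrability is essential, because the
  Bochner integral of a function that is not integrable is zero.\<close>

lemma moment_Suc_nonzero:
  assumes int: "set_integrable lborel {0<..}
           (\<lambda>t. complex_of_real (t ^ k) * e (complex_of_real (ln t)))"
    and pos: "\<And>x. x > 0 \<Longrightarrow> e (complex_of_real (ln x)) \<in> \<real> \<and> Re (e (complex_of_real (ln x))) > 0"
  shows "moment e (Suc k) \<noteq> 0"
proof
  assume zero: "moment e (Suc k) = 0"
  define g where "g t = indicat_real {0<..} t * (t ^ k * Re (e (complex_of_real (ln t))))" for t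
  have eq: "indicat_real {0<..} t *\<^sub>R (complex_of_real (t ^ k) * e (complex_of_real (ln t)))
      = complex_of_real (g t)" for t
    using pos[of t] by (auto simp: g_def indicator_def complex_is_Real_iff complex_eq_iff)
  have intg: "integrable lborel g"
    using int by (simp only: set_integrable_def eq complex_of_real_integrable_eq)
  have "moment e (Suc k) = (LINT t|lborel. complex_of_real (g t))"
    by (simp add: moment_def set_lebesgue_integral_def eq[simplified])
  hence "(LINT t|lborel. g t) = 0" using zero by simp
  moreover have "g t \<ge> 0" for t using pos[of t] by (auto simp: g_def indicator_def)
  ultimately have "AE t in lborel. g t = 0"
    using integral_nonneg_eq_0_iff_AE[OF intg] by simp
  hence "AE t in lborel. t \<notin> {0<..<1::real}"
    by eventually_elim (use pos in \<open>force simp: g_def indicator_def\<close>)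
  hence "{0<..<1::real} \<in> null_sets lborel"
    by (subst AE_iff_null_sets) auto
  thus False by (simp add: null_sets_def)
qed

text \<open>The Cauchy inequality on the circle of radius \<open>K\<^sub>4 M\<^sub>p\<^sub>+\<^sub>1 / M\<^sub>p\<close>. There the associated function is attained
  at the index \<open>p\<close>, so that the power of the radius cancels up to \<open>K\<^sub>4\<^sup>p\<close>.\<close>

lemma entire_coeff_bound:
  fixes c :: "nat \<Rightarrow> complex"
  assumes M: "\<And>p. M p > 0" and lc: "\<And>p. p \<ge> 1 \<Longrightarrow> (M p)\<^sup>2 \<le> M (p - 1) * M (p + 1)"
    and E: "\<And>z. (\<lambda>p. c p * z ^ p) sums E z"
    and K: "K3 > 0" "K4 > 0" and bound: "\<And>z. norm (E z) \<le> K3 * exp (assoc_fun M (norm z / K4))"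
  shows "norm (c p) \<le> K3 / (K4 ^ p * M p)"
proof -
  define t where "t = M (p + 1) / M p"
  have t: "t > 0" using M by (simp add: t_def)
  define r where "r = K4 * t"
  have r: "r > 0" using K t by (simp add: r_def)
  have rad: "fps_conv_radius (Abs_fps c) = \<infinity>"
    unfolding fps_conv_radius_def
    by (rule conv_radius_inftyI'') (use E sums_summable in \<open>auto simp: mult.commute\<close>)
  have ev: "E = eval_fps (Abs_fps c)"
    using E by (auto simp: eval_fps_def sums_iff)
  have exp: "E has_fps_expansion Abs_fps c"
    unfolding ev using rad by (intro eval_fps_has_fps_expansion) auto
  have hol: "E holomorphic_on S" for S
    unfolding ev using rad by (intro holomorphic_on_eval_fps) auto
  have "norm ((deriv ^^ p) E 0) \<le> fact p * (K3 * (t ^ p / M p)) / r ^ p"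
  proof (rule Cauchy_inequality)
    fix x :: complex assume "norm (0 - x) = r"
    hence *: "norm x / K4 = t" using K by (simp add: r_def)
    have "norm (E x) \<le> K3 * exp (assoc_fun M t)" using bound[of x] * by simp
    also have "exp (assoc_fun M t) \<le> t ^ p / M p"
      using log_convex_term_max[of M, OF M lc] by (intro exp_assoc_fun_le M t) (auto simp: t_def)
    finally show "norm (E x) \<le> K3 * (t ^ p / M p)" using K by simp
  qed (auto intro: hol holomorphic_on_imp_continuous_on r)
  moreover have "c p = (deriv ^^ p) E 0 / fact p"
    using fps_nth_fps_expansion[OF exp, of p] by simp
  ultimately have "norm (c p) \<le> fact p * (K3 * (t ^ p / M p)) / r ^ p / fact p"
    by (simp only: norm_divide norm_fact divide_right_mono fact_ge_zero)
  hence "norm (c p) \<le> K3 * (t ^ p / M p) / r ^ p" by simp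
  also have "\<dots> = K3 / (K4 ^ p * M p)"
    using t K by (simp add: r_def power_mult_distrib)
  finally show ?thesis .
qed

text \<open>These three properties are all that the algebraic part needs to know about the kernel. Only the
  moment \<open>m(0)\<close> escapes the integral estimates, as \<open>t\<^sup>-\<^sup>1\<close> is not controlled near zero by them; it is
  normalised to one.\<close>

lemma kernel_moment_growth:
  assumes "kernel_moment_sequence m"
  shows "\<And>p. m p \<noteq> 0"
    and "\<And>z::complex. summable (\<lambda>p. z ^ p / complex_of_real (m p))"
    and "\<exists>B C. C > 0 \<and> (\<forall>p. \<bar>m (Suc p)\<bar> \<le> B * C ^ p * \<bar>m p\<bar>)"
proof -
  obtain M e E where sr: "strongly_regular M" and prox: "admits_nonzero_proximate_order M"
    and root: "filterlim (\<lambda>p. root p (M p)) at_top sequentially"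
    and ker: "kernel_pair M e E" and mom: "\<And>p. complex_of_real (m p) = moment e p"
    and m0: "m 0 = 1"
    using assms by (auto simp: kernel_moment_sequence_def)
  have M: "\<And>p. M p > 0" and lc: "\<And>p. p \<ge> 1 \<Longrightarrow> (M p)\<^sup>2 \<le> M (p - 1) * M (p + 1)"
    using sr by (auto simp: strongly_regular_def)
  obtain A where A: "A > 0" "\<And>p q. M (p + q) \<le> A ^ (p + q) * M p * M q"
    using sr unfolding strongly_regular_def by blast
  \<comment> \<open>Any margin less than the opening leaves the positive axis inside the smaller sector.\<close>
  define \<delta> where "\<delta> = kernel_opening M / 2"
  have \<delta>: "\<delta> > 0" "kernel_opening M - \<delta> > 0" "kernel_opening M > 0"
    using kernel_opening_pos[OF prox] by (auto simp: \<delta>_def)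
  have hol: "e holomorphic_on log_sector 0 (kernel_opening M)"
    and pos: "\<And>x. x > 0 \<Longrightarrow> e (complex_of_real (ln x)) \<in> \<real> \<and> Re (e (complex_of_real (ln x))) > 0"
    and sums: "\<And>z. (\<lambda>p. z ^ p / moment e p) sums E z"
    using ker unfolding kernel_pair_def by blast+
  have "\<exists>K1>0. \<exists>K2>0. \<forall>w \<in> log_sector 0 (kernel_opening M - \<delta>).
        norm (e w) \<le> K1 * exp (- assoc_fun M (norm (exp w) / K2))"
    using ker \<delta>(1) unfolding kernel_pair_def by blast
  then obtain K1 K2 where K12: "K1 > 0" "K2 > 0"
    and e: "\<And>w. w \<in> log_sector 0 (kernel_opening M - \<delta>) \<Longrightarrow>
        norm (e w) \<le> K1 * exp (- assoc_fun M (norm (exp w) / K2))"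
    by blast
  have "\<exists>K3>0. \<exists>K4>0. \<forall>z. norm (E z) \<le> K3 * exp (assoc_fun M (norm z / K4))"
    using ker unfolding kernel_pair_def by (elim conjE)
  then obtain K3 K4 where K34: "K3 > 0" "K4 > 0"
    and Eb: "\<And>z. norm (E z) \<le> K3 * exp (assoc_fun M (norm z / K4))"
    by blast
  have ereal: "norm (e (complex_of_real (ln t))) \<le> K1 * exp (- assoc_fun M (t / K2))" if "t > 0" for t
    using e[of "complex_of_real (ln t)"] that \<delta> by (simp add: log_sector_def exp_of_real)
  have cont: "continuous_on {0<..} (\<lambda>t. e (complex_of_real (ln t)))"
    using \<delta> by (intro continuous_on_compose2[OF holomorphic_on_imp_continuous_on[OF hol]]
        continuous_intros) (auto simp: log_sector_def)
  note est = moment_Suc_estimate[OF M root cont K12 ereal]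
  show nz: "m p \<noteq> 0" for p
  proof (cases p)
    case (Suc k)
    thus ?thesis using moment_Suc_nonzero[OF est(1) pos, of k] mom[of p] by auto
  qed (simp add: m0)
  show "summable (\<lambda>p. z ^ p / complex_of_real (m p))" for z :: complex
    using sums[of z] by (simp add: mom sums_iff)
  define J where "J = (LINT t:{0<..}|lborel. inverse (1 + (t::real)\<^sup>2))"
  have J: "J \<ge> 0"
    unfolding J_def set_lebesgue_integral_def by (intro Bochner_Integration.integral_nonneg) auto
  have lower: "M p \<le> K3 / K4 ^ p * \<bar>m p\<bar>" for p
  proof -
    have "norm (1 / moment e p) \<le> K3 / (K4 ^ p * M p)"
      by (rule entire_coeff_bound[OF M lc _ K34 Eb]) (use sums in \<open>auto simp: divide_inverse mult.commute\<close>)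
    hence "1 / \<bar>m p\<bar> \<le> K3 / (K4 ^ p * M p)"
      by (simp add: mom[symmetric] norm_divide)
    thus ?thesis using nz[of p] M[of p] K34 by (simp add: field_simps)
  qed
  have upper: "\<bar>m (Suc p)\<bar> \<le> K1 * J * (1 + K2\<^sup>2 * A\<^sup>2 * M 2) * (K2 * (1 + A)) ^ p * M p" for p
  proof -
    \<comment> \<open>The base \<open>1 + A\<close> dominates both \<open>1\<close> and \<open>A\<close>, so a single geometric factor covers both summands.\<close>
    have pA: "1 \<le> (1 + A) ^ p" "A ^ p \<le> (1 + A) ^ p"
      using A(1) by (auto intro: one_le_power power_mono)
    have "\<bar>m (Suc p)\<bar> \<le> K1 * (K2 ^ p * M p + K2 ^ (p + 2) * M (p + 2)) * J"
      using est(2)[of p] by (simp add: mom[symmetric] J_def)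
    also have "\<dots> \<le> K1 * (K2 ^ p * M p + K2 ^ (p + 2) * (A ^ (p + 2) * M p * M 2)) * J"
      using K12 J A(2)[of p 2] by (intro mult_right_mono mult_left_mono add_mono) auto
    also have "\<dots> = K1 * J * K2 ^ p * M p * (1 + K2\<^sup>2 * A\<^sup>2 * M 2 * A ^ p)"
      by (simp add: power_add power2_eq_square algebra_simps)
    also have "\<dots> \<le> K1 * J * K2 ^ p * M p * ((1 + A) ^ p + K2\<^sup>2 * A\<^sup>2 * M 2 * (1 + A) ^ p)"
      using K12 J M[of p] M[of 2] pA by (intro mult_left_mono add_mono) auto
    finally show ?thesis by (simp only: power_mult_distrib) (simp add: algebra_simps)
  qed
  show "\<exists>B C. C > 0 \<and> (\<forall>p. \<bar>m (Suc p)\<bar> \<le> B * C ^ p * \<bar>m p\<bar>)"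
  proof (intro exI conjI allI)
    let ?B = "K1 * J * (1 + K2\<^sup>2 * A\<^sup>2 * M 2)"
    show "K2 * (1 + A) / K4 > 0" using K12 K34 A by simp
    fix p
    have "\<bar>m (Suc p)\<bar> \<le> ?B * (K2 * (1 + A)) ^ p * (K3 / K4 ^ p * \<bar>m p\<bar>)"
      using K12 J M[of 2] A(1) by (intro order_trans[OF upper] mult_left_mono lower) auto
    also have "\<dots> = (?B * K3) * (K2 * (1 + A) / K4) ^ p * \<bar>m p\<bar>"
      by (simp add: power_divide)
    finally show "\<bar>m (Suc p)\<bar> \<le> (?B * K3) * (K2 * (1 + A) / K4) ^ p * \<bar>m p\<bar>" .
  qed
qed

section \<open>Moment differentiation of entire functions\<close>

definition moment_deriv_fps :: "(nat \<Rightarrow> real) \<Rightarrow> complex fps \<Rightarrow> complex fps" where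
  "moment_deriv_fps m F = Abs_fps (\<lambda>p.
      complex_of_real (m (p + 1)) * fps_nth F (p + 1) / complex_of_real (m p))"

lemma moment_deriv_eval_fps:
  assumes "fps_conv_radius F = \<infinity>"
  shows "moment_deriv m (eval_fps F) = eval_fps (moment_deriv_fps m F)"
proof -
  have "eval_fps F has_fps_expansion F"
    using assms by (intro eval_fps_has_fps_expansion) auto
  hence "fps_expansion (eval_fps F) 0 = F" by (rule fps_expansion_eqI)
  thus ?thesis by (simp add: moment_deriv_def moment_deriv_fps_def)
qed

text \<open>The shifted series of \<open>F\<close> converges absolutely at \<open>C z\<close>, and the geometric ratio bound makes it a
  majorant of the moment derivative at \<open>z\<close>.\<close>

lemma fps_conv_radius_moment_deriv:
  assumes F: "fps_conv_radius F = \<infinity>" and nz: "\<And>p. m p \<noteq> 0"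
    and C: "C > 0" and ratio: "\<And>p. \<bar>m (Suc p)\<bar> \<le> B * C ^ p * \<bar>m p\<bar>"
  shows "fps_conv_radius (moment_deriv_fps m F) = \<infinity>"
  unfolding fps_conv_radius_def
proof (rule conv_radius_inftyI'')
  fix z :: complex
  have "summable (\<lambda>p. norm (fps_nth (fps_shift 1 F) p * (complex_of_real C * z) ^ p))"
    using F by (intro norm_summable_fps) auto
  hence sum: "summable (\<lambda>p. B * norm (fps_nth (fps_shift 1 F) p * (complex_of_real C * z) ^ p))"
    by (rule summable_mult)
  show "summable (\<lambda>p. fps_nth (moment_deriv_fps m F) p * z ^ p)"
  proof (rule summable_comparison_test'[OF sum, of 0])
    fix p
    have "\<bar>m (Suc p)\<bar> / \<bar>m p\<bar> \<le> B * C ^ p"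
      using ratio[of p] nz[of p] by (simp add: pos_divide_le_eq)
    hence "\<bar>m (Suc p)\<bar> / \<bar>m p\<bar> * (norm (fps_nth F (Suc p)) * norm z ^ p)
        \<le> B * C ^ p * (norm (fps_nth F (Suc p)) * norm z ^ p)"
      by (intro mult_right_mono) auto
    thus "norm (fps_nth (moment_deriv_fps m F) p * z ^ p)
        \<le> B * norm (fps_nth (fps_shift 1 F) p * (complex_of_real C * z) ^ p)"
      using C by (simp add: moment_deriv_fps_def norm_mult norm_divide norm_power power_mult_distrib mult_ac)
  qed
qed

section \<open>The generalized matrix exponential\<close>

text \<open>The sum of all entries of \<open>A\<close> in absolute value dominates every row sum, hence serves as \<open>K\<close>.\<close>

lemma matrix_power_entry_bound:
  fixes A :: "complex ^ 'n ^ 'n"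
  obtains K where "K \<ge> 0" "\<And>p i j. norm (matrix_power A p $ i $ j) \<le> K ^ p"
proof -
  define a where "a = (\<Sum>i\<in>UNIV. \<Sum>j\<in>UNIV. norm (A $ i $ j))"
  have row: "(\<Sum>k\<in>UNIV. norm (A $ i $ k)) \<le> a" for i
    unfolding a_def by (rule member_le_sum) (auto intro: sum_nonneg)
  have a0: "a \<ge> 0" by (auto simp: a_def intro!: sum_nonneg)
  have "norm (matrix_power A p $ i $ j) \<le> a ^ p" for p i j
  proof (induction p arbitrary: i j)
    case 0 show ?case by (simp add: mat_def)
  next
    case (Suc p)
    have "norm (matrix_power A (Suc p) $ i $ j) \<le> (\<Sum>k\<in>UNIV. norm (A $ i $ k) * norm (matrix_power A p $ k $ j))"
      by (simp add: matrix_matrix_mult_def norm_mult[symmetric] norm_sum)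
    also have "\<dots> \<le> (\<Sum>k\<in>UNIV. norm (A $ i $ k) * a ^ p)"
      by (intro sum_mono mult_left_mono Suc.IH) auto
    also have "\<dots> \<le> a * a ^ p"
      unfolding sum_distrib_right[symmetric] using row a0 by (intro mult_right_mono) auto
    finally show ?case by simp
  qed
  with a0 show thesis by (rule that)
qed

text \<open>The Taylor series of the \<open>i\<close>-th component of \<open>E(A z) v\<close>. Working with the component series reduces
  the vector equation to identities between scalar power series.\<close>

definition matrix_exp_fps ::
    "(nat \<Rightarrow> real) \<Rightarrow> complex ^ 'n ^ 'n \<Rightarrow> complex ^ 'n \<Rightarrow> 'n \<Rightarrow> complex fps" where
  "matrix_exp_fps m A v i = Abs_fps (\<lambda>p. (matrix_power A p *v v) $ i / complex_of_real (m p))"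

lemma matrix_exp_sums:
  fixes A :: "complex ^ 'n ^ 'n"
  assumes ent: "\<And>z::complex. summable (\<lambda>p. z ^ p / complex_of_real (m p))"
  shows "(\<lambda>p. fps_nth (matrix_exp_fps m A v i) p * z ^ p) sums (gen_matrix_exp m A z *v v) $ i"
proof -
  obtain K where K: "K \<ge> 0" "\<And>p i j. norm (matrix_power A p $ i $ j) \<le> K ^ p"
    using matrix_power_entry_bound[of A] by blast
  define I where "I = Abs_fps (\<lambda>p. 1 / complex_of_real (m p))"
  have "fps_conv_radius I = \<infinity>"
    unfolding fps_conv_radius_def I_def by (rule conv_radius_inftyI'') (use ent in simp)
  hence sum: "summable (\<lambda>p. norm (fps_nth I p * (complex_of_real K * z) ^ p))"
    by (intro norm_summable_fps) auto
  have "summable (\<lambda>p. matrix_power A p $ i $ j / complex_of_real (m p) * z ^ p)" for j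
  proof (rule summable_comparison_test'[OF sum, of 0])
    fix p
    have "norm (matrix_power A p $ i $ j) * (norm z ^ p / \<bar>m p\<bar>) \<le> K ^ p * (norm z ^ p / \<bar>m p\<bar>)"
      by (intro mult_right_mono K) auto
    thus "norm (matrix_power A p $ i $ j / complex_of_real (m p) * z ^ p)
        \<le> norm (fps_nth I p * (complex_of_real K * z) ^ p)"
      using K(1) by (simp add: I_def norm_mult norm_divide norm_power power_mult_distrib)
  qed
  hence "(\<lambda>p. matrix_power A p $ i $ j / complex_of_real (m p) * z ^ p * v $ j)
      sums (gen_matrix_exp m A z $ i $ j * v $ j)" for j
    by (intro sums_mult2) (simp add: gen_matrix_exp_def summable_sums)
  hence "(\<lambda>p. \<Sum>j\<in>UNIV. matrix_power A p $ i $ j / complex_of_real (m p) * z ^ p * v $ j)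
      sums (\<Sum>j\<in>UNIV. gen_matrix_exp m A z $ i $ j * v $ j)"
    by (intro sums_sum)
  thus ?thesis
    by (simp add: matrix_exp_fps_def matrix_vector_mult_def sum_divide_distrib sum_distrib_left
        mult_ac)
qed

lemma matrix_exp_eval_fps:
  fixes A :: "complex ^ 'n ^ 'n"
  assumes ent: "\<And>z::complex. summable (\<lambda>p. z ^ p / complex_of_real (m p))"
  shows "fps_conv_radius (matrix_exp_fps m A v i) = \<infinity>"
    and "(gen_matrix_exp m A z *v v) $ i = eval_fps (matrix_exp_fps m A v i) z"
proof -
  show "fps_conv_radius (matrix_exp_fps m A v i) = \<infinity>"
    unfolding fps_conv_radius_def
    by (rule conv_radius_inftyI'') (rule sums_summable[OF matrix_exp_sums[OF ent]])
  show "(gen_matrix_exp m A z *v v) $ i = eval_fps (matrix_exp_fps m A v i) z"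
    using matrix_exp_sums[OF ent, of A v i z] by (simp add: eval_fps_def sums_iff)
qed

lemma eval_fps_lincomb:
  fixes F :: "'n::finite \<Rightarrow> complex fps"
  assumes "\<And>j. fps_conv_radius (F j) = \<infinity>"
  shows "(\<lambda>p. (\<Sum>j\<in>UNIV. a j * fps_nth (F j) p) * z ^ p) sums (\<Sum>j\<in>UNIV. a j * eval_fps (F j) z)"
proof -
  have "(\<lambda>p. \<Sum>j\<in>UNIV. a j * (fps_nth (F j) p * z ^ p)) sums (\<Sum>j\<in>UNIV. a j * eval_fps (F j) z)"
    using assms by (intro sums_sum sums_mult sums_eval_fps) auto
  thus ?thesis by (simp add: sum_distrib_right mult.assoc)
qed

text \<open>On coefficients, the moment derivative replaces \<open>A\<^sup>p v / m(p)\<close> by \<open>A\<^sup>p\<^sup>+\<^sup>1 v / m(p)\<close>, which is \<open>A\<close> applied to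
  the former.\<close>

lemma gen_matrix_exp_solves:
  fixes A :: "complex ^ 'n ^ 'n" and v :: "complex ^ 'n"
  assumes nz: "\<And>p. m p \<noteq> 0" and ent: "\<And>z::complex. summable (\<lambda>p. z ^ p / complex_of_real (m p))"
  defines "y \<equiv> (\<lambda>z. gen_matrix_exp m A z *v v)"
  shows "(\<lambda>z. y z $ (i :: 'n)) holomorphic_on UNIV" and "moment_deriv_vec m y z = A *v y z"
proof -
  note rad = matrix_exp_eval_fps(1)[OF ent, of A v]
  have y: "(\<lambda>z. y z $ i) = eval_fps (matrix_exp_fps m A v i)" for i
    unfolding y_def by (rule ext) (rule matrix_exp_eval_fps(2)[OF ent])
  show "(\<lambda>z. y z $ i) holomorphic_on UNIV"
    unfolding y using rad[of i] by (intro holomorphic_on_eval_fps) auto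
  show "moment_deriv_vec m y z = A *v y z"
  proof (simp add: vec_eq_iff, rule allI)
    fix i
    have coeff: "fps_nth (moment_deriv_fps m (matrix_exp_fps m A v i)) p
        = (\<Sum>j\<in>UNIV. A $ i $ j * fps_nth (matrix_exp_fps m A v j) p)" for p
    proof -
      have "fps_nth (moment_deriv_fps m (matrix_exp_fps m A v i)) p
        = (A *v (matrix_power A p *v v)) $ i / complex_of_real (m p)"
        using nz[of "Suc p"]
        by (simp add: moment_deriv_fps_def matrix_exp_fps_def matrix_vector_mul_assoc)
      also have "\<dots> = (\<Sum>j\<in>UNIV. A $ i $ j * fps_nth (matrix_exp_fps m A v j) p)"
        by (simp add: matrix_vector_mult_def[of A] matrix_exp_fps_def sum_divide_distrib)
      finally show ?thesis .
    qed
    have "moment_deriv_vec m y z $ i = eval_fps (moment_deriv_fps m (matrix_exp_fps m A v i)) z"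
      by (simp add: moment_deriv_vec_def y moment_deriv_eval_fps rad)
    also have "\<dots> = (\<Sum>j\<in>UNIV. A $ i $ j * eval_fps (matrix_exp_fps m A v j) z)"
      using eval_fps_lincomb[where F = "matrix_exp_fps m A v", OF rad, where a = "\<lambda>j. A $ i $ j" and z = z]
      by (simp add: eval_fps_def coeff sums_iff)
    also have "\<dots> = (A *v y z) $ i"
      by (simp add: matrix_vector_mult_def[of A] y[THEN fun_cong, symmetric])
    finally show "moment_deriv_vec m y z $ i = (A *v y z) $ i" .
  qed
qed

text \<open>By the ratio bound, both sides of the equation are entire functions given by their Taylor series.
  Their coefficients agree, and the resulting recursion determines all coefficients from \<open>y 0\<close>.\<close>

lemma solution_eq_gen_matrix_exp:
  fixes y :: "complex \<Rightarrow> complex ^ 'n"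
  assumes nz: "\<And>p. m p \<noteq> 0" and m0: "m 0 = 1"
    and ent: "\<And>z::complex. summable (\<lambda>p. z ^ p / complex_of_real (m p))"
    and C: "C > 0" and ratio: "\<And>p. \<bar>m (Suc p)\<bar> \<le> B * C ^ p * \<bar>m p\<bar>"
    and hol: "\<And>i. (\<lambda>z. y z $ i) holomorphic_on UNIV"
    and eq: "\<And>z. moment_deriv_vec m y z = A *v y z"
  shows "y z = gen_matrix_exp m A z *v y 0"
proof -
  define F where "F i = fps_expansion (\<lambda>z. y z $ i) 0" for i
  have hol': "(\<lambda>z. y z $ i) holomorphic_on eball 0 \<infinity>" for i using hol by simp
  have rad: "fps_conv_radius (F i) = \<infinity>" for i
    using conv_radius_fps_expansion[OF hol', of i] by (simp add: F_def)
  have y: "(\<lambda>z. y z $ i) = eval_fps (F i)" for i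
    using eval_fps_expansion'[OF hol', of _ i] by (auto simp: F_def)
  have rec: "complex_of_real (m (Suc p)) * fps_nth (F i) (Suc p) / complex_of_real (m p)
      = (\<Sum>j\<in>UNIV. A $ i $ j * fps_nth (F j) p)" for p i
  proof -
    let ?L = "moment_deriv_fps m (F i)"
    let ?R = "Abs_fps (\<lambda>p. \<Sum>j\<in>UNIV. A $ i $ j * fps_nth (F j) p)"
    note sR = eval_fps_lincomb[where F = F, OF rad, where a = "\<lambda>j. A $ i $ j"]
    have rL: "fps_conv_radius ?L = \<infinity>"
      by (rule fps_conv_radius_moment_deriv[OF rad nz C ratio])
    have rR: "fps_conv_radius ?R = \<infinity>"
      unfolding fps_conv_radius_def
      by (rule conv_radius_inftyI'') (use sR sums_summable in fastforce)
    have "eval_fps ?L z = eval_fps ?R z" for z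
    proof -
      have "eval_fps ?L z = moment_deriv_vec m y z $ i"
        by (simp add: moment_deriv_vec_def y moment_deriv_eval_fps rad)
      also have "\<dots> = (\<Sum>j\<in>UNIV. A $ i $ j * eval_fps (F j) z)"
        by (simp add: eq matrix_vector_mult_def y[THEN fun_cong])
      also have "\<dots> = eval_fps ?R z"
        using sR[of z] by (simp add: eval_fps_def sums_iff)
      finally show ?thesis .
    qed
    hence "?L = ?R" by (intro eval_fps_eqD) (auto simp: rL rR)
    thus ?thesis by (simp add: fps_eq_iff moment_deriv_fps_def)
  qed
  have coeff: "fps_nth (F i) p = (matrix_power A p *v y 0) $ i / complex_of_real (m p)" for p i
  proof (induction p arbitrary: i)
    case 0
    have "y 0 $ i = eval_fps (F i) 0" using y[THEN fun_cong] .
    thus ?case by (simp add: m0 eval_fps_at_0)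
  next
    case (Suc p)
    have "complex_of_real (m (Suc p)) * fps_nth (F i) (Suc p)
        = complex_of_real (m p) * (\<Sum>j\<in>UNIV. A $ i $ j * fps_nth (F j) p)"
      using rec[of p i] nz[of p] by (simp add: field_simps)
    also have "\<dots> = (A *v (matrix_power A p *v y 0)) $ i"
      using nz[of p] by (simp add: Suc.IH matrix_vector_mult_def[of A] sum_distrib_left)
    finally show ?case
      using nz[of "Suc p"] by (simp add: matrix_vector_mul_assoc field_simps)
  qed
  have "F i = matrix_exp_fps m A (y 0) i" for i
    by (simp add: fps_eq_iff coeff matrix_exp_fps_def)
  hence "y z $ i = (gen_matrix_exp m A z *v y 0) $ i" for i
    by (simp add: y[THEN fun_cong] matrix_exp_eval_fps(2)[OF ent])
  thus ?thesis by (simp add: vec_eq_iff)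
qed

theorem theorem3p3:
  fixes m :: "nat \<Rightarrow> real" and A :: "complex ^ 'n ^ 'n"
  assumes "kernel_moment_sequence m"
    and "diagonalizable A"
  shows "{y :: complex \<Rightarrow> complex ^ 'n.
            (\<forall>i. (\<lambda>z. y z $ i) holomorphic_on UNIV) \<and>
            (\<forall>z. moment_deriv_vec m y z = A *v y z)}
         = {y. \<exists>v :: complex ^ 'n. y = (\<lambda>z. gen_matrix_exp m A z *v v)}"
proof -
  note mom = kernel_moment_growth[OF assms(1)]
  have m0: "m 0 = 1" using assms(1) by (simp add: kernel_moment_sequence_def)
  obtain B C where "C > 0" "\<And>p. \<bar>m (Suc p)\<bar> \<le> B * C ^ p * \<bar>m p\<bar>"
    using mom(3) by blast
  note unique = solution_eq_gen_matrix_exp[OF mom(1) m0 mom(2) this]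
  show ?thesis (is "?S = ?T")
  proof
    show "?S \<subseteq> ?T"
    proof
      fix y assume "y \<in> ?S"
      hence "y = (\<lambda>z. gen_matrix_exp m A z *v y 0)"
        by (intro ext unique) auto
      thus "y \<in> ?T" by blast
    qed
    show "?T \<subseteq> ?S"
      using gen_matrix_exp_solves[OF mom(1,2)] by blast
  qed
qed

end
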